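(* For every $\varphi,\psi\in L^\infty(\mathbb{T})$, $$D_{\varphi\psi}^{\mathcal{M}}-D_\varphi^{\mathcal{M}}D_\psi^{\mathcal{M}}=H_\varphi^{\mathcal{M}}(H_{\bar\psi}^{\mathcal{M}})^*.$$
   Context: $\mathbb{D}$ is the open unit disk, $\mathbb{T}=\partial\mathbb{D}$, and $L^2(\mathbb{T})$ is taken with respect to normalized Lebesgue measure $m$, with inner product linear in the first variable. $H^2\subset L^2(\mathbb{T})$ is the Hardy space (functions with vanishing negative Fourier coefficients, also viewed as analytic functions on $\mathbb{D}$). For $f\in H^2$, $S^*f=(f-f(0))/z$. For an inner function $u$, $\mathcal{K}_u=H^2\ominus uH^2$. A closed subspace $\mathcal{M}\subset H^2$ is nearly $S^*$-invariant if $f\in\mathcal{M}$, $f(0)=0$ imply $S^*f\in\mathcal{M}$. Setting: $\mathcal{M}=h\mathcal{K}_u$ is a nonzero proper closed nearly $S^*$-invariant subspace of $H^2$, where $u$ is a nonconstant inner function with $u(0)=0$ and $h\in\mathcal{M}$ is the extremal function of $\mathcal{M}$: $\|h\|_2=1$, $h(0)>0$, $h\perp\{f\in\mathcal{M}:f(0)=0\}$, and multiplication by $h$ is an isometry from $\mathcal{K}_u$ onto $\mathcal{M}$. $\mathcal{M}^\perp=L^2(\mathbb{T})\ominus\mathcal{M}$, and $P_{\mathcal{M}^\perp}$ is the orthogonal projection of $L^2(\mathbb{T})$ onto it. $M_\varphi f=\varphi f$ on $L^2(\mathbb{T})$, and $D_\varphi^{\mathcal{M}}=P_{\mathcal{M}^\perp}M_\varphi|_{\mathcal{M}^\perp}:\mathcal{M}^\perp\to\mathcal{M}^\perp$.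 $V:\mathcal{K}_u\to L^2(\mathbb{T})$, $Vk=hk$, is an isometry with range $\mathcal{M}$. The weighted truncated Hankel operator with symbol $\varphi\in L^\infty(\mathbb{T})$ is $H_\varphi^{\mathcal{M}}=P_{\mathcal{M}^\perp}M_\varphi V:\mathcal{K}_u\to\mathcal{M}^\perp$. *)

theory Defs
  imports "HOL-Probability.Probability"
begin

section \<open>Measurable functions on the unit circle modulo null sets\<close>

definition circle_measure :: "complex measure" where
  "circle_measure =
     distr (uniform_measure lborel {0..<2 * pi}) (restrict_space borel (sphere 0 1)) cis"

lemma space_circle_measure [simp]: "space circle_measure = sphere 0 1"
  by (simp add: circle_measure_def space_restrict_space)

lemma sets_circle_measure [simp, measurable_cong]:
  "sets circle_measure = sets (restrict_space borel (sphere 0 1))"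
  by (simp add: circle_measure_def)

lemma prob_space_circle_measure: "prob_space circle_measure"
proof -
  have "cis \<in> borel \<rightarrow>\<^sub>M borel"
    by (intro borel_measurable_continuous_onI continuous_intros)
  then have "cis \<in> borel_measurable (uniform_measure lborel {0..<2 * pi})"
    by (simp add: measurable_def)
  then have "cis \<in> uniform_measure lborel {0..<2 * pi} \<rightarrow>\<^sub>M restrict_space borel (sphere 0 1)"
    by (rule measurable_restrict_space2[rotated]) auto
  moreover have "prob_space (uniform_measure lborel {0..<2 * pi})"
    by (intro prob_space_uniform_measure) auto
  ultimately show ?thesis
    unfolding circle_measure_def by (intro prob_space.prob_space_distr)
qed

lemma borel_measurable_cnj [measurable]: "cnj \<in> borel_measurable borel"
  by (intro borel_measurable_continuous_onI continuous_intros)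

lemma borel_measurable_ident_circle [measurable]:
  "(\<lambda>z. z) \<in> borel_measurable circle_measure"
  unfolding circle_measure_def by (simp add: measurable_restrict_space1)

lemma borel_measurable_powi_circle [measurable]:
  "(\<lambda>z. z powi n) \<in> borel_measurable circle_measure"
  proof (cases "n \<ge> 0")
  case True
  then show ?thesis by (simp add: power_int_def)
next
  case False
  then show ?thesis by (simp add: power_int_def)
qed

text \<open>
  The quotient contains all measurable functions, so that pointwise multiplication is total;
  \<open>L\<^sup>2\<close>, \<open>L\<^sup>\<infinity>\<close> and \<open>H\<^sup>2\<close> are subsets of this ring.
\<close>

quotient_type circle_fun = "complex \<Rightarrow> complex" / partial:
  "\<lambda>f g. f \<in> borel_measurable circle_measure \<and> g \<in> borel_measurable circle_measure \<and>
         (AE z in circle_measure. f z = g z)"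
proof (rule part_equivpI)
  show "\<exists>f. f \<in> borel_measurable circle_measure \<and> f \<in> borel_measurable circle_measure \<and>
         (AE z in circle_measure. f z = (f z :: complex))"
    by (rule exI[of _ "\<lambda>_. 0"]) auto
next
  show "symp (\<lambda>f g. f \<in> borel_measurable circle_measure \<and> g \<in> borel_measurable circle_measure \<and>
      (AE z in circle_measure. f z = (g z :: complex)))"
    by (rule sympI) (auto elim: eventually_mono)
  show "transp (\<lambda>f g. f \<in> borel_measurable circle_measure \<and> g \<in> borel_measurable circle_measure \<and>
      (AE z in circle_measure. f z = (g z :: complex)))"
    by (rule transpI) (auto elim: eventually_elim2)
qed

instantiation circle_fun :: comm_ring_1
begin

lift_definition zero_circle_fun :: circle_fun is "\<lambda>_. 0" by simp
lift_definition one_circle_fun :: circle_fun is "\<lambda>_. 1" by simp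
lift_definition plus_circle_fun :: "circle_fun \<Rightarrow> circle_fun \<Rightarrow> circle_fun" is
  "\<lambda>f g z. f z + g z" by auto
lift_definition minus_circle_fun :: "circle_fun \<Rightarrow> circle_fun \<Rightarrow> circle_fun" is
  "\<lambda>f g z. f z - g z" by auto
lift_definition uminus_circle_fun :: "circle_fun \<Rightarrow> circle_fun" is
  "\<lambda>f z. - f z" by auto
lift_definition times_circle_fun :: "circle_fun \<Rightarrow> circle_fun \<Rightarrow> circle_fun" is
  "\<lambda>f g z. f z * g z" by auto

instance
proof
  show "(0 :: circle_fun) \<noteq> 1"
    by transfer (simp add: prob_space.AE_const[OF prob_space_circle_measure])
qed (transfer; auto simp: algebra_simps)+

end

lift_definition const_fun :: "complex \<Rightarrow> circle_fun" is "\<lambda>c _. c" by simp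

lift_definition cnj_fun :: "circle_fun \<Rightarrow> circle_fun" is "\<lambda>f z. cnj (f z)"
  by auto

lift_definition div_z :: "circle_fun \<Rightarrow> circle_fun" is "\<lambda>f z. f z / z"
  by auto

section \<open>The spaces \<open>L\<^sup>2\<close>, \<open>L\<^sup>\<infinity>\<close> and \<open>H\<^sup>2\<close>\<close>

lift_definition square_integrable :: "circle_fun \<Rightarrow> bool" is
  "\<lambda>f. integrable circle_measure (\<lambda>z. (cmod (f z))\<^sup>2)"
  by (intro integrable_cong_AE) auto

lift_definition essentially_bounded :: "circle_fun \<Rightarrow> bool" is
  "\<lambda>f. \<exists>C. AE z in circle_measure. cmod (f z) \<le> C"
proof -
  fix f g :: "complex \<Rightarrow> complex"
  assume "f \<in> borel_measurable circle_measure \<and> g \<in> borel_measurable circle_measure \<and>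
    (AE z in circle_measure. f z = g z)"
  then have ae: "AE z in circle_measure. f z = g z" by blast
  have "(AE z in circle_measure. cmod (f z) \<le> C) \<longleftrightarrow>
      (AE z in circle_measure. cmod (g z) \<le> C)" for C
    using ae by auto
  then show "(\<exists>C. AE z in circle_measure. cmod (f z) \<le> C) \<longleftrightarrow>
      (\<exists>C. AE z in circle_measure. cmod (g z) \<le> C)"
    by simp
qed

lift_definition unimodular :: "circle_fun \<Rightarrow> bool" is
  "\<lambda>f. AE z in circle_measure. cmod (f z) = 1"
  by auto

definition L2 :: "circle_fun set" where "L2 = {f. square_integrable f}"

definition Linf :: "circle_fun set" where "Linf = {f. essentially_bounded f}"

lift_definition l2_inner :: "circle_fun \<Rightarrow> circle_fun \<Rightarrow> complex" is
  "\<lambda>f g. \<integral>z. f z * cnj (g z) \<partial>circle_measure"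
  by (intro integral_cong_AE) auto

definition l2_norm :: "circle_fun \<Rightarrow> real" where "l2_norm f = sqrt (Re (l2_inner f f))"

abbreviation l2_topology :: "circle_fun topology" where
  "l2_topology \<equiv> Metric_space.mtopology L2 (\<lambda>f g. l2_norm (f - g))"

definition ominus :: "circle_fun set \<Rightarrow> circle_fun set \<Rightarrow> circle_fun set" (infixl "\<ominus>" 65) where
  "A \<ominus> B = {f \<in> A. \<forall>g \<in> B. l2_inner f g = 0}"

lift_definition fourier_coeff :: "circle_fun \<Rightarrow> int \<Rightarrow> complex" is
  "\<lambda>f n. \<integral>z. f z * z powi (- n) \<partial>circle_measure"
  by (intro ext integral_cong_AE) auto

definition H2 :: "circle_fun set" where
  "H2 = {f \<in> L2. \<forall>n < 0. fourier_coeff f n = 0}"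

text \<open>The analytic function on the unit disk whose boundary function is \<open>f \<in> H\<^sup>2\<close>.\<close>

definition disk_ext :: "circle_fun \<Rightarrow> complex \<Rightarrow> complex" where
  "disk_ext f w = (\<Sum>n. fourier_coeff f (int n) * w ^ n)"

definition backward_shift :: "circle_fun \<Rightarrow> circle_fun" where
  "backward_shift f = div_z (f - const_fun (disk_ext f 0))"

definition inner_function :: "circle_fun \<Rightarrow> bool" where
  "inner_function u \<longleftrightarrow> u \<in> H2 \<and> unimodular u"

definition model_space :: "circle_fun \<Rightarrow> circle_fun set" where
  "model_space u = H2 \<ominus> (\<lambda>f. u * f) ` H2"

section \<open>Nearly invariant subspaces and their operators\<close>

definition closed_subspace_of :: "circle_fun set \<Rightarrow> circle_fun set \<Rightarrow> bool" where
  "closed_subspace_of M A \<longleftrightarrow>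
     M \<subseteq> A \<and> module.subspace (\<lambda>c f. const_fun c * f) M \<and> closedin l2_topology M"

definition nearly_invariant :: "circle_fun set \<Rightarrow> bool" where
  "nearly_invariant M \<longleftrightarrow>
     closed_subspace_of M H2 \<and> (\<forall>f \<in> M. disk_ext f 0 = 0 \<longrightarrow> backward_shift f \<in> M)"

definition extremal_function :: "circle_fun set \<Rightarrow> circle_fun \<Rightarrow> bool" where
  "extremal_function M h \<longleftrightarrow>
     h \<in> M \<and> l2_norm h = 1 \<and> disk_ext h 0 \<in> \<real> \<and> Re (disk_ext h 0) > 0 \<and>
     (\<forall>f \<in> M. disk_ext f 0 = 0 \<longrightarrow> l2_inner h f = 0)"

definition isometry_onto ::
    "(circle_fun \<Rightarrow> circle_fun) \<Rightarrow> circle_fun set \<Rightarrow> circle_fun set \<Rightarrow> bool" where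
  "isometry_onto T A B \<longleftrightarrow> T ` A = B \<and> (\<forall>f \<in> A. l2_norm (T f) = l2_norm f)"

text \<open>
  The next two definitions are meaningful for a closed subspace \<open>N\<close> of \<open>L\<^sup>2\<close> and \<open>f \<in> L\<^sup>2\<close>, and for
  a bounded operator \<open>T\<close> from a closed subspace \<open>A\<close> of \<open>L\<^sup>2\<close> into a subspace containing \<open>g\<close>.
\<close>

definition oproj :: "circle_fun set \<Rightarrow> circle_fun \<Rightarrow> circle_fun" where
  "oproj N f = (THE g. g \<in> N \<and> (\<forall>k \<in> N. l2_inner (f - g) k = 0))"

definition adjoint_on ::
    "circle_fun set \<Rightarrow> (circle_fun \<Rightarrow> circle_fun) \<Rightarrow> circle_fun \<Rightarrow> circle_fun" where
  "adjoint_on A T g = (THE k. k \<in> A \<and> (\<forall>x \<in> A. l2_inner (T x) g = l2_inner x k))"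

definition dual_trunc_toeplitz ::
    "circle_fun set \<Rightarrow> circle_fun \<Rightarrow> circle_fun \<Rightarrow> circle_fun" where
  "dual_trunc_toeplitz M \<phi> f = oproj (L2 \<ominus> M) (\<phi> * f)"

definition weighted_trunc_hankel ::
    "circle_fun set \<Rightarrow> circle_fun \<Rightarrow> circle_fun \<Rightarrow> circle_fun \<Rightarrow> circle_fun" where
  "weighted_trunc_hankel M h \<phi> k = oproj (L2 \<ominus> M) (\<phi> * (h * k))"

end

theory Submission
  imports Defs
begin

text \<open>
  Write \<open>P\<close> for the orthogonal projection of \<open>L\<^sup>2\<close> onto \<open>M\<close> and \<open>Q = 1 - P\<close> for the one onto
  \<open>M\<^sup>\<bottom>\<close>. For \<open>f \<in> M\<^sup>\<bottom>\<close> the left-hand side is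
  \<open>Q (\<phi> \<psi> f) - Q (\<phi> Q (\<psi> f)) = Q (\<phi> P (\<psi> f))\<close>. Since \<open>V k = h k\<close> maps the model space
  isometrically onto \<open>M\<close>, there is a \<open>k\<close> in the model space with \<open>P (\<psi> f) = h k\<close>, and this \<open>k\<close> is
  the value at \<open>f\<close> of the adjoint of the Hankel operator with symbol \<open>cnj \<psi>\<close>:
  for \<open>x\<close> in the model space,
  \<open>\<langle>Q (cnj \<psi> h x), f\<rangle> = \<langle>h x, \<psi> f\<rangle> = \<langle>h x, P (\<psi> f)\<rangle> = \<langle>h x, h k\<rangle> = \<langle>x, k\<rangle>\<close>.
  Hence the right-hand side is \<open>Q (\<phi> h k) = Q (\<phi> P (\<psi> f))\<close> as well.

  Two ingredients of this computation need work. The first is that \<open>P\<close> exists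
  (\<open>L2_orthogonal_decomposition\<close>): \<open>M\<close> is closed, so this is the Hilbert space projection theorem
  (\<open>orthogonal_projection_exists\<close>) together with the Riesz--Fischer theorem
  (\<open>square_integrable_complete\<close>). The two are brought together on a type \<open>l2\<close> whose elements are
  those of \<open>L\<^sup>2\<close> and which is a complete real inner product space under the real part of the inner
  product. The second is that \<open>V\<close>, which is only known to preserve norms, preserves inner
  products (\<open>isometry_onto_mult_preserves_l2_inner\<close>); this is polarization, and it needs the model
  space to be a linear subspace.
\<close>

section \<open>Completeness of square-integrable functions\<close>

lemma square_integrable_diff:
  fixes f g :: "'a \<Rightarrow> 'b::{banach, second_countable_topology}"
  assumes [measurable]: "f \<in> borel_measurable M" "g \<in> borel_measurable M"
    and f: "integrable M (\<lambda>x. (norm (f x))\<^sup>2)" and g: "integrable M (\<lambda>x. (norm (g x))\<^sup>2)"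
  shows "integrable M (\<lambda>x. (norm (f x - g x))\<^sup>2)"
proof (rule Bochner_Integration.integrable_bound)
  show "integrable M (\<lambda>x. 2 * (norm (f x))\<^sup>2 + 2 * (norm (g x))\<^sup>2)"
    using f g by simp
  have "(norm (f x - g x))\<^sup>2 \<le> 2 * (norm (f x))\<^sup>2 + 2 * (norm (g x))\<^sup>2" for x
  proof -
    have "(norm (f x - g x))\<^sup>2 \<le> (norm (f x) + norm (g x))\<^sup>2"
      by (intro power_mono norm_triangle_ineq4) auto
    also have "\<dots> \<le> 2 * (norm (f x))\<^sup>2 + 2 * (norm (g x))\<^sup>2"
      using sum_squares_bound[of "norm (f x)" "norm (g x)"] by (simp add: power2_sum)
    finally show ?thesis .
  qed
  then show "AE x in M. norm ((norm (f x - g x))\<^sup>2) \<le> norm (2 * (norm (f x))\<^sup>2 + 2 * (norm (g x))\<^sup>2)"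
    by (auto intro!: always_eventually order_trans[OF _ abs_ge_self])
qed measurable

text \<open>
  Along a subsequence whose successive differences have squared \<open>L\<^sup>2\<close> norms at most \<open>4\<^sup>-\<^sup>k\<close>, the sum of
  the absolute differences has a finite integral (the measure being finite), so it is finite almost
  everywhere and the telescoping series converges there.
\<close>
lemma square_integrable_Cauchy_AE_convergent_subseq:
  fixes f :: "nat \<Rightarrow> 'a \<Rightarrow> 'b::{banach, second_countable_topology}"
  assumes "finite_measure M"
    and [measurable]: "\<And>n. f n \<in> borel_measurable M"
    and fi: "\<And>n. integrable M (\<lambda>x. (norm (f n x))\<^sup>2)"
    and Cauchy: "\<And>e. e > 0 \<Longrightarrow> \<exists>N. \<forall>m\<ge>N. \<forall>n\<ge>N. (\<integral>x. (norm (f m x - f n x))\<^sup>2 \<partial>M) < e"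
  shows "\<exists>r. strict_mono r \<and> (AE x in M. convergent (\<lambda>k. f (r k) x))"
proof -
  interpret finite_measure M by fact
  obtain N where N: "\<And>k m n. m \<ge> N k \<Longrightarrow> n \<ge> N k \<Longrightarrow> (\<integral>x. (norm (f m x - f n x))\<^sup>2 \<partial>M) < (1/4)^k"
    using Cauchy[of "(1/4)^k" for k] by (atomize_elim, intro choice) auto
  define r where "r k = k + (\<Sum>i\<le>k. N i)" for k
  have r: "strict_mono r"
    by (auto simp: strict_mono_Suc_iff r_def)
  have rN: "r k \<ge> N k" for k
    unfolding r_def by (simp add: trans_le_add2 member_le_sum)
  define d where "d k x = norm (f (r (Suc k)) x - f (r k) x)" for k x
  have [measurable]: "d k \<in> borel_measurable M" for k
    unfolding d_def by measurable
  have d2: "integrable M (\<lambda>x. (d k x)\<^sup>2)" "(\<integral>x. (d k x)\<^sup>2 \<partial>M) \<le> (1/4)^k" for k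
    unfolding d_def using N[of k "r (Suc k)" "r k"] rN[of k] strict_mono_less[OF r, of k "Suc k"]
    by (auto intro!: square_integrable_diff fi)
  \<comment> \<open>The \<open>L\<^sup>1\<close> norm of \<open>d k\<close> is controlled by its \<open>L\<^sup>2\<close> norm: with the weight \<open>2^k\<close>,
    both terms of the bound integrate to \<open>O(2^-k)\<close>, which is summable.\<close>
  have AMGM: "d k x \<le> (1/2)^k + 2^k * (d k x)\<^sup>2" for k x
  proof -
    have "2 * (2^k * d k x) \<le> 1 + (2^k * d k x)\<^sup>2"
      using sum_squares_bound[of 1 "2^k * d k x"] by simp
    then have "d k x \<le> ((1/2)^k + 2^k * (d k x)\<^sup>2) / 2"
      by (simp add: field_simps power2_eq_square power_divide)
    also have "\<dots> \<le> (1/2)^k + 2^k * (d k x)\<^sup>2"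
      by (simp add: add_nonneg_nonneg)
    finally show ?thesis .
  qed
  have "(\<integral>\<^sup>+x. ennreal (d k x) \<partial>M) \<le> ennreal ((1/2)^k * (measure M (space M) + 1))" for k
  proof -
    have int: "integrable M (\<lambda>x. (1/2)^k + 2^k * (d k x)\<^sup>2)"
      using d2 by simp
    have "(\<integral>\<^sup>+x. ennreal (d k x) \<partial>M) \<le> (\<integral>\<^sup>+x. ennreal ((1/2)^k + 2^k * (d k x)\<^sup>2) \<partial>M)"
      using AMGM by (intro nn_integral_mono ennreal_leI) auto
    also have "\<dots> = ennreal (\<integral>x. (1/2)^k + 2^k * (d k x)\<^sup>2 \<partial>M)"
      using int by (intro nn_integral_eq_integral) auto
    also have "(\<integral>x. (1/2)^k + 2^k * (d k x)\<^sup>2 \<partial>M) = (1/2)^k * measure M (space M) + 2^k * (\<integral>x. (d k x)\<^sup>2 \<partial>M)"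
      using d2 by simp
    also have "ennreal \<dots> \<le> ennreal ((1/2)^k * measure M (space M) + 2^k * (1/4)^k)"
      using d2(2)[of k] by (intro ennreal_leI add_mono mult_left_mono) auto
    also have "2^k * (1/4::real)^k = (1/2)^k"
      by (simp flip: power_mult_distrib)
    finally show ?thesis by (simp add: algebra_simps)
  qed
  then have "(\<Sum>k. \<integral>\<^sup>+x. ennreal (d k x) \<partial>M) \<le> (\<Sum>k. ennreal ((1/2)^k * (measure M (space M) + 1)))"
    by (intro suminf_le) auto
  also have "\<dots> < \<infinity>"
    by (subst suminf_ennreal2) (auto intro!: summable_mult2 add_nonneg_nonneg simp: ennreal_less_top)
  finally have "(\<integral>\<^sup>+x. (\<Sum>k. ennreal (d k x)) \<partial>M) \<noteq> \<infinity>"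
    by (subst nn_integral_suminf) auto
  then have "AE x in M. (\<Sum>k. ennreal (d k x)) \<noteq> \<infinity>"
    by (intro nn_integral_noteq_infinite) auto
  then have "AE x in M. convergent (\<lambda>k. f (r k) x)"
  proof (rule AE_mp[OF _ AE_I2], intro impI)
    fix x assume "(\<Sum>k. ennreal (d k x)) \<noteq> \<infinity>"
    then have "summable (\<lambda>k. d k x)"
      by (intro summable_suminf_not_top) (auto simp: d_def)
    then have "summable (\<lambda>k. f (r (Suc k)) x - f (r k) x)"
      unfolding d_def by (rule summable_norm_cancel)
    then have "convergent (\<lambda>n. \<Sum>k<n. f (r (Suc k)) x - f (r k) x)"
      by (simp add: summable_iff_convergent)
    then have "convergent (\<lambda>n. f (r n) x - f (r 0) x)"
      by (subst (asm) sum_lessThan_telescope)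
    then show "convergent (\<lambda>k. f (r k) x)"
      by (simp only: convergent_diff_const_right_iff)
  qed
  with r show ?thesis by blast
qed

text \<open>
  Riesz--Fischer for \<open>L\<^sup>2\<close> of a finite measure. The limit is the almost-everywhere limit of a
  subsequence; that the whole sequence converges to it in the mean follows from Fatou's lemma
  applied to the differences of a fixed member from that subsequence.
\<close>
lemma square_integrable_complete:
  fixes f :: "nat \<Rightarrow> 'a \<Rightarrow> 'b::{banach, second_countable_topology}"
  assumes "finite_measure M"
    and [measurable]: "\<And>n. f n \<in> borel_measurable M"
    and fi: "\<And>n. integrable M (\<lambda>x. (norm (f n x))\<^sup>2)"
    and Cauchy: "\<And>e. e > 0 \<Longrightarrow> \<exists>N. \<forall>m\<ge>N. \<forall>n\<ge>N. (\<integral>x. (norm (f m x - f n x))\<^sup>2 \<partial>M) < e"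
  shows "\<exists>g \<in> borel_measurable M. integrable M (\<lambda>x. (norm (g x))\<^sup>2) \<and>
    (\<forall>e>0. \<exists>N. \<forall>n\<ge>N. (\<integral>x. (norm (f n x - g x))\<^sup>2 \<partial>M) \<le> e)"
proof -
  obtain r where r: "strict_mono r" and conv: "AE x in M. convergent (\<lambda>k. f (r k) x)"
    using square_integrable_Cauchy_AE_convergent_subseq[OF assms] by blast
  define g where "g x = lim (\<lambda>k. f (r k) x)" for x
  have [measurable]: "g \<in> borel_measurable M"
    unfolding g_def by measurable
  have bound: "(\<integral>\<^sup>+x. ennreal ((norm (f n x - g x))\<^sup>2) \<partial>M) \<le> ennreal e"
    if N: "\<And>m n. m \<ge> N \<Longrightarrow> n \<ge> N \<Longrightarrow> (\<integral>x. (norm (f m x - f n x))\<^sup>2 \<partial>M) < e" and n: "n \<ge> N" for e N n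
  proof -
    have "(\<integral>\<^sup>+x. ennreal ((norm (f n x - g x))\<^sup>2) \<partial>M)
        = (\<integral>\<^sup>+x. liminf (\<lambda>k. ennreal ((norm (f n x - f (r k) x))\<^sup>2)) \<partial>M)"
    proof (rule nn_integral_cong_AE, rule AE_mp[OF conv AE_I2], intro impI)
      fix x assume "convergent (\<lambda>k. f (r k) x)"
      then have "(\<lambda>k. f (r k) x) \<longlonglongrightarrow> g x"
        by (simp add: g_def convergent_LIMSEQ_iff)
      then have "(\<lambda>k. ennreal ((norm (f n x - f (r k) x))\<^sup>2)) \<longlonglongrightarrow> ennreal ((norm (f n x - g x))\<^sup>2)"
        by (intro tendsto_ennrealI tendsto_intros)
      then show "ennreal ((norm (f n x - g x))\<^sup>2) = liminf (\<lambda>k. ennreal ((norm (f n x - f (r k) x))\<^sup>2))"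
        by (intro lim_imp_Liminf[symmetric]) auto
    qed
    also have "\<dots> \<le> liminf (\<lambda>k. \<integral>\<^sup>+x. ennreal ((norm (f n x - f (r k) x))\<^sup>2) \<partial>M)"
      by (intro nn_integral_liminf) measurable
    also have "\<dots> \<le> ennreal e"
    proof (rule Liminf_le)
      have "(\<integral>\<^sup>+x. ennreal ((norm (f n x - f (r k) x))\<^sup>2) \<partial>M) \<le> ennreal e" if "k \<ge> N" for k
      proof -
        have "r k \<ge> N"
          using that seq_suble[OF r, of k] by simp
        then show ?thesis
          using N[OF n, of "r k"]
          by (subst nn_integral_eq_integral) (auto intro!: square_integrable_diff fi ennreal_leI)
      qed
      then show "\<forall>\<^sub>F k in sequentially. (\<integral>\<^sup>+x. ennreal ((norm (f n x - f (r k) x))\<^sup>2) \<partial>M) \<le> ennreal e"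
        by (auto simp: eventually_sequentially)
    qed simp
    finally show ?thesis .
  qed
  have dist: "integrable M (\<lambda>x. (norm (f n x - g x))\<^sup>2) \<and> (\<integral>x. (norm (f n x - g x))\<^sup>2 \<partial>M) \<le> e"
    if "\<And>m n. m \<ge> N \<Longrightarrow> n \<ge> N \<Longrightarrow> (\<integral>x. (norm (f m x - f n x))\<^sup>2 \<partial>M) < e" "n \<ge> N" "e > 0" for e N n
  proof
    show "integrable M (\<lambda>x. (norm (f n x - g x))\<^sup>2)"
      using bound[OF that(1,2)] by (intro integrableI_nonneg) (auto intro: le_less_trans simp: ennreal_less_top)
    then show "(\<integral>x. (norm (f n x - g x))\<^sup>2 \<partial>M) \<le> e"
      using bound[OF that(1,2)] \<open>e > 0\<close> by (simp add: nn_integral_eq_integral)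
  qed
  have "integrable M (\<lambda>x. (norm (g x))\<^sup>2)"
  proof -
    obtain N where "\<And>m n. m \<ge> N \<Longrightarrow> n \<ge> N \<Longrightarrow> (\<integral>x. (norm (f m x - f n x))\<^sup>2 \<partial>M) < 1"
      using Cauchy[of 1] by auto
    then have "integrable M (\<lambda>x. (norm (f N x - g x))\<^sup>2)"
      using dist[of N 1 N] by auto
    from square_integrable_diff[OF _ _ fi[of N] this] show ?thesis by simp
  qed
  moreover have "\<exists>N. \<forall>n\<ge>N. (\<integral>x. (norm (f n x - g x))\<^sup>2 \<partial>M) \<le> e" if "e > 0" for e
    using Cauchy[OF that] dist[OF _ _ that] by meson
  ultimately show ?thesis by (intro bexI[of _ g]) auto
qed

section \<open>Orthogonal projection in a Hilbert space\<close>

text \<open>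
  The projection is a point of \<open>S\<close> at minimal distance from \<open>x\<close>. A minimizing sequence is Cauchy by
  the parallelogram law, because the midpoints of its members lie in \<open>S\<close> and so are not closer to
  \<open>x\<close> than the infimum. At a minimizing point \<open>p\<close> the residue is orthogonal to every \<open>k\<close>, since
  otherwise moving \<open>p\<close> in direction \<open>k\<close> would decrease the distance.
\<close>
lemma orthogonal_projection_exists:
  fixes S :: "'a::{real_inner, complete_space} set"
  assumes S: "subspace S" "closed S"
  shows "\<exists>p\<in>S. \<forall>k\<in>S. inner (x - p) k = 0"
proof -
  define D where "D = Inf ((\<lambda>y. (norm (x - y))\<^sup>2) ` S)"
  have bdd: "bdd_below ((\<lambda>y. (norm (x - y))\<^sup>2) ` S)"
    by (intro bdd_belowI[of _ 0]) auto
  have S0: "0 \<in> S" using S(1) by (rule subspace_0)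
  have D: "D \<le> (norm (x - y))\<^sup>2" if "y \<in> S" for y
    unfolding D_def using bdd that by (intro cInf_lower) auto
  have "\<exists>y\<in>S. (norm (x - y))\<^sup>2 < D + 1 / Suc n" for n
  proof -
    have "Inf ((\<lambda>y. (norm (x - y))\<^sup>2) ` S) < D + 1 / Suc n"
      unfolding D_def by (simp add: field_simps)
    then show ?thesis
      using S0 bdd by (subst (asm) cInf_less_iff) auto
  qed
  then obtain y where y: "\<And>n. y n \<in> S" "\<And>n. (norm (x - y n))\<^sup>2 < D + 1 / Suc n"
    by metis
  have para: "(norm (y m - y n))\<^sup>2 \<le> 2 * (1 / Suc m) + 2 * (1 / Suc n)" for m n
  proof -
    have "(1/2) *\<^sub>R (y m + y n) \<in> S"
      using S y by (intro subspace_scale subspace_add) auto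
    then have "4 * D \<le> 4 * (norm (x - (1/2) *\<^sub>R (y m + y n)))\<^sup>2"
      using D by auto
    also have "\<dots> = 2 * (norm (x - y m))\<^sup>2 + 2 * (norm (x - y n))\<^sup>2 - (norm (y m - y n))\<^sup>2"
      by (simp add: power2_norm_eq_inner inner_simps inner_commute algebra_simps)
    finally show ?thesis
      using y(2)[of m] y(2)[of n] by linarith
  qed
  have "Cauchy y"
  proof (rule metric_CauchyI)
    fix e :: real assume e: "e > 0"
    then obtain N where N: "4 / e\<^sup>2 < real N"
      using reals_Archimedean2 by blast
    have "dist (y m) (y n) < e" if "m \<ge> N" "n \<ge> N" for m n
    proof -
      have "1 / Suc k < e\<^sup>2 / 4" if "k \<ge> N" for k
      proof -
        have "4 / e\<^sup>2 < Suc k" using N that by linarith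
        then show ?thesis using e by (simp add: field_simps)
      qed
      from this[OF \<open>m \<ge> N\<close>] this[OF \<open>n \<ge> N\<close>] have "(norm (y m - y n))\<^sup>2 < e\<^sup>2"
        using para[of m n] by linarith
      then show ?thesis
        using e by (simp add: dist_norm power_less_imp_less_base)
    qed
    then show "\<exists>N. \<forall>m\<ge>N. \<forall>n\<ge>N. dist (y m) (y n) < e" by blast
  qed
  then obtain p where p: "p \<in> S" "y \<longlonglongrightarrow> p"
    using S(2) y(1) by (metis Cauchy_convergent_iff convergentD closed_sequentially)
  have xp: "(norm (x - p))\<^sup>2 \<le> D"
  proof (rule LIMSEQ_le)
    show "(\<lambda>n. (norm (x - y n))\<^sup>2) \<longlonglongrightarrow> (norm (x - p))\<^sup>2"
      using p(2) by (intro tendsto_intros)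
    show "(\<lambda>n. D + 1 / Suc n) \<longlonglongrightarrow> D"
      using tendsto_add[OF tendsto_const lim_1_over_n[THEN LIMSEQ_Suc], of D] by simp
  qed (use y(2) less_imp_le in blast)
  have "inner (x - p) k = 0" if "k \<in> S" for k
  proof (rule ccontr)
    assume ne: "inner (x - p) k \<noteq> 0"
    then have k: "inner k k > 0" by auto
    \<comment> \<open>The minimizer of the quadratic \<open>t \<mapsto> (norm (x - (p + t k)))\<^sup>2\<close>.\<close>
    define t where "t = inner (x - p) k / inner k k"
    have "p + t *\<^sub>R k \<in> S"
      using S(1) p(1) that by (intro subspace_add subspace_scale)
    then have "(norm (x - p))\<^sup>2 \<le> (norm (x - (p + t *\<^sub>R k)))\<^sup>2"
      using D xp by (meson order_trans)
    also have "\<dots> = (norm (x - p))\<^sup>2 - 2 * t * inner (x - p) k + t\<^sup>2 * inner k k"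
      unfolding power2_norm_eq_inner
      by (simp add: inner_simps inner_commute algebra_simps power2_eq_square)
    also have "\<dots> = (norm (x - p))\<^sup>2 - (inner (x - p) k)\<^sup>2 / inner k k"
      using k by (simp add: t_def field_simps power2_eq_square)
    finally have "(inner (x - p) k)\<^sup>2 / inner k k \<le> 0" by simp
    moreover have "(inner (x - p) k)\<^sup>2 / inner k k > 0" using ne k by simp
    ultimately show False by simp
  qed
  with p(1) show ?thesis by blast
qed


section \<open>The inner product on \<open>L\<^sup>2\<close> of the circle\<close>

lemma L2_Linf_mult:
  assumes "\<phi> \<in> Linf" "f \<in> L2"
  shows "\<phi> * f \<in> L2"
  using assms unfolding L2_def Linf_def mem_Collect_eq
proof transfer
  fix \<phi> f :: "complex \<Rightarrow> complex"
  assume "\<phi> \<in> borel_measurable circle_measure \<and> \<phi> \<in> borel_measurable circle_measure \<and> (AE z in circle_measure. \<phi> z = \<phi> z)"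
    and "f \<in> borel_measurable circle_measure \<and> f \<in> borel_measurable circle_measure \<and> (AE z in circle_measure. f z = f z)"
  then have [measurable]: "\<phi> \<in> borel_measurable circle_measure" "f \<in> borel_measurable circle_measure"
    by auto
  assume "\<exists>C. AE z in circle_measure. cmod (\<phi> z) \<le> C"
    and f: "integrable circle_measure (\<lambda>z. (cmod (f z))\<^sup>2)"
  then obtain C where C: "AE z in circle_measure. cmod (\<phi> z) \<le> C" by blast
  show "integrable circle_measure (\<lambda>z. (cmod (\<phi> z * f z))\<^sup>2)"
  proof (rule Bochner_Integration.integrable_bound)
    show "integrable circle_measure (\<lambda>z. C\<^sup>2 * (cmod (f z))\<^sup>2)"
      using f by simp
    show "AE z in circle_measure. norm ((cmod (\<phi> z * f z))\<^sup>2) \<le> norm (C\<^sup>2 * (cmod (f z))\<^sup>2)"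
      using C by eventually_elim
        (auto simp: norm_mult power_mult_distrib intro!: mult_right_mono power_mono)
  qed measurable
qed

lemma L2_diff:
  assumes "f \<in> L2" "g \<in> L2"
  shows "f - g \<in> L2"
  using assms unfolding L2_def mem_Collect_eq
  by transfer (auto intro!: square_integrable_diff)

lemma zero_in_L2: "0 \<in> L2"
  unfolding L2_def mem_Collect_eq by transfer simp

lemma L2_minus: "f \<in> L2 \<Longrightarrow> - f \<in> L2"
  using L2_diff[OF zero_in_L2] by simp

lemma L2_add:
  assumes "f \<in> L2" "g \<in> L2"
  shows "f + g \<in> L2"
  using L2_diff[OF assms(1) L2_minus[OF assms(2)]] by simp

lemma const_fun_in_Linf: "const_fun c \<in> Linf"
  unfolding Linf_def mem_Collect_eq by transfer auto

lemma L2_scale: "f \<in> L2 \<Longrightarrow> const_fun c * f \<in> L2"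
  by (intro L2_Linf_mult const_fun_in_Linf)

lemma integrable_mult_cnj:
  assumes [measurable]: "f \<in> borel_measurable M" "g \<in> borel_measurable M"
    and f: "integrable M (\<lambda>x. (cmod (f x))\<^sup>2)" and g: "integrable M (\<lambda>x. (cmod (g x))\<^sup>2)"
  shows "integrable M (\<lambda>x. f x * cnj (g x))"
proof (rule Bochner_Integration.integrable_bound)
  show "integrable M (\<lambda>x. (cmod (f x))\<^sup>2 + (cmod (g x))\<^sup>2)"
    using f g by simp
  have "cmod (f x * cnj (g x)) \<le> (cmod (f x))\<^sup>2 + (cmod (g x))\<^sup>2" for x
    using sum_squares_bound[of "cmod (f x)" "cmod (g x)"]
      mult_nonneg_nonneg[OF norm_ge_zero norm_ge_zero, of "f x" "g x"]
    unfolding norm_mult complex_mod_cnj by linarith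
  then show "AE x in M. cmod (f x * cnj (g x)) \<le> norm ((cmod (f x))\<^sup>2 + (cmod (g x))\<^sup>2)"
    by (auto intro!: always_eventually)
qed measurable

lemma l2_inner_diff_left:
  assumes "f \<in> L2" "g \<in> L2" "k \<in> L2"
  shows "l2_inner (f - g) k = l2_inner f k - l2_inner g k"
  using assms unfolding L2_def mem_Collect_eq
  by transfer (auto simp: ring_distribs integrable_mult_cnj intro!: Bochner_Integration.integral_diff)

lemma l2_inner_scale_left: "l2_inner (const_fun c * f) g = c * l2_inner f g"
  by transfer (simp add: mult.assoc)

lemma l2_inner_zero_left [simp]: "l2_inner 0 g = 0"
  by transfer simp

lemma cnj_l2_inner: "cnj (l2_inner f g) = l2_inner g f"
  by transfer (simp flip: Bochner_Integration.integral_cnj add: mult.commute)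

lemma l2_inner_mult_left: "l2_inner (\<phi> * f) g = l2_inner f (cnj_fun \<phi> * g)"
  by transfer (simp add: mult_ac)

lemma cnj_fun_cnj_fun [simp]: "cnj_fun (cnj_fun f) = f"
  by transfer auto

lemma cnj_fun_in_Linf: "f \<in> Linf \<Longrightarrow> cnj_fun f \<in> Linf"
  unfolding Linf_def mem_Collect_eq by transfer simp

lemma Im_l2_inner_self [simp]: "Im (l2_inner f f) = 0"
  by transfer (simp flip: complex_norm_square del: of_real_power)

lemma Re_l2_inner_self_nonneg [simp]: "Re (l2_inner f f) \<ge> 0"
  by transfer (simp flip: complex_norm_square del: of_real_power)

lemma Re_l2_inner_self_eq_0_iff:
  assumes "f \<in> L2"
  shows "Re (l2_inner f f) = 0 \<longleftrightarrow> f = 0"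
  using assms unfolding L2_def mem_Collect_eq
  by transfer (auto simp: integral_nonneg_eq_0_iff_AE simp flip: complex_norm_square simp del: of_real_power)

lemma integral_self_mult_cnj:
  "(\<integral>z. f z * cnj (f z) \<partial>M) = complex_of_real (\<integral>z. (cmod (f z))\<^sup>2 \<partial>M)"
  by (simp flip: complex_norm_square del: of_real_power)

lemma L2_complete:
  fixes F :: "nat \<Rightarrow> circle_fun"
  assumes "\<And>n. F n \<in> L2"
    and "\<And>e. e > 0 \<Longrightarrow> \<exists>N. \<forall>m\<ge>N. \<forall>n\<ge>N. Re (l2_inner (F m - F n) (F m - F n)) < e"
  shows "\<exists>G\<in>L2. \<forall>e>0. \<exists>N. \<forall>n\<ge>N. Re (l2_inner (F n - G) (F n - G)) \<le> e"
proof -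
  have "(\<forall>n. square_integrable (F n)) \<longrightarrow>
    (\<forall>e>0. \<exists>N. \<forall>m\<ge>N. \<forall>n\<ge>N. Re (l2_inner (F m - F n) (F m - F n)) < e) \<longrightarrow>
    (\<exists>G. square_integrable G \<and> (\<forall>e>0. \<exists>N. \<forall>n\<ge>N. Re (l2_inner (F n - G) (F n - G)) \<le> e))"
  proof (transfer, unfold integral_self_mult_cnj Re_complex_of_real, simp, intro allI impI)
    fix F :: "nat \<Rightarrow> complex \<Rightarrow> complex"
    interpret prob_space circle_measure by (rule prob_space_circle_measure)
    assume "\<forall>n. F n \<in> borel_measurable circle_measure"
      and "\<forall>n. integrable circle_measure (\<lambda>z. (cmod (F n z))\<^sup>2)"
      and "\<forall>e>0. \<exists>N. \<forall>m\<ge>N. \<forall>n\<ge>N. (\<integral>z. (cmod (F m z - F n z))\<^sup>2 \<partial>circle_measure) < e"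
    then show "\<exists>G\<in>borel_measurable circle_measure. integrable circle_measure (\<lambda>z. (cmod (G z))\<^sup>2) \<and>
      (\<forall>e>0. \<exists>N. \<forall>n\<ge>N. (\<integral>z. (cmod (F n z - G z))\<^sup>2 \<partial>circle_measure) \<le> e)"
      by (intro square_integrable_complete finite_measure_axioms) auto
  qed
  then show ?thesis
    using assms by (auto simp: L2_def)
qed

lemma module_circle_fun: "module (\<lambda>c f. const_fun c * f)"
proof
  show "const_fun a * (x + y) = const_fun a * x + const_fun a * y" for a x y
    by (simp add: ring_distribs)
  show "const_fun (a + b) * x = const_fun a * x + const_fun b * x" for a b x
    by transfer (auto simp: ring_distribs)
  show "const_fun a * (const_fun b * x) = const_fun (a * b) * x" for a b x
    by transfer (auto simp: mult.assoc)
  show "const_fun 1 * x = x" for x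
    by transfer auto
qed

lemma l2_inner_add_left:
  assumes "f \<in> L2" "g \<in> L2" "k \<in> L2"
  shows "l2_inner (f + g) k = l2_inner f k + l2_inner g k"
  using l2_inner_diff_left[OF L2_add[OF assms(1,2)] assms(2,3)] by simp

lemma l2_inner_add_right:
  assumes "f \<in> L2" "g \<in> L2" "k \<in> L2"
  shows "l2_inner k (f + g) = l2_inner k f + l2_inner k g"
  using l2_inner_add_left[OF assms] by (metis cnj_l2_inner complex_cnj_add)

lemma l2_inner_diff_right:
  assumes "f \<in> L2" "g \<in> L2" "k \<in> L2"
  shows "l2_inner k (f - g) = l2_inner k f - l2_inner k g"
  using l2_inner_diff_left[OF assms] by (metis cnj_l2_inner complex_cnj_diff)

lemma l2_inner_scale_right: "l2_inner f (const_fun c * g) = cnj c * l2_inner f g"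
  using l2_inner_scale_left[of c g f] by (metis cnj_l2_inner complex_cnj_mult)

section \<open>\<open>L\<^sup>2\<close> as a real Hilbert space\<close>

text \<open>
  A type is used because the notions of inner product space and completeness that the projection
  theorem refers to are type classes.
\<close>
typedef l2 = L2
  using zero_in_L2 by blast

setup_lifting type_definition_l2

instantiation l2 :: real_inner
begin

lift_definition zero_l2 :: l2 is 0 by (rule zero_in_L2)
lift_definition plus_l2 :: "l2 \<Rightarrow> l2 \<Rightarrow> l2" is "(+)" by (rule L2_add)
lift_definition minus_l2 :: "l2 \<Rightarrow> l2 \<Rightarrow> l2" is "(-)" by (rule L2_diff)
lift_definition uminus_l2 :: "l2 \<Rightarrow> l2" is uminus by (rule L2_minus)
lift_definition scaleR_l2 :: "real \<Rightarrow> l2 \<Rightarrow> l2" is "\<lambda>r f. const_fun (of_real r) * f"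
  by (rule L2_scale)
lift_definition inner_l2 :: "l2 \<Rightarrow> l2 \<Rightarrow> real" is "\<lambda>f g. Re (l2_inner f g)" .
definition norm_l2 :: "l2 \<Rightarrow> real" where "norm_l2 x = sqrt (inner x x)"
definition dist_l2 :: "l2 \<Rightarrow> l2 \<Rightarrow> real" where "dist_l2 x y = norm (x - y)"
definition sgn_l2 :: "l2 \<Rightarrow> l2" where "sgn_l2 x = inverse (norm x) *\<^sub>R x"
definition uniformity_l2 :: "(l2 \<times> l2) filter" where
  "uniformity_l2 = (INF e\<in>{0<..}. principal {(x, y). dist x y < e})"
definition open_l2 :: "l2 set \<Rightarrow> bool" where
  "open_l2 U \<longleftrightarrow> (\<forall>x\<in>U. eventually (\<lambda>(x', y). x' = x \<longrightarrow> y \<in> U) uniformity)"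

instance
proof
  fix x y z :: l2 and a b :: real
  show "x + y + z = x + (y + z)" "x + y = y + x" "0 + x = x" "- x + x = 0" "x - y = x + - y"
    by (transfer, simp)+
  show "a *\<^sub>R (x + y) = a *\<^sub>R x + a *\<^sub>R y" "(a + b) *\<^sub>R x = a *\<^sub>R x + b *\<^sub>R x"
    "a *\<^sub>R b *\<^sub>R x = (a * b) *\<^sub>R x" "1 *\<^sub>R x = x"
    by (transfer, simp add: module.scale_right_distrib[OF module_circle_fun]
      module.scale_left_distrib[OF module_circle_fun]
      module.scale_scale[OF module_circle_fun] module.scale_one[OF module_circle_fun])+
  show "inner x y = inner y x"
    by transfer (metis cnj_l2_inner complex_cnj(1) complex.sel(1) complex.collapse)
  show "inner (x + y) z = inner x z + inner y z"
    by transfer (simp add: l2_inner_add_left)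
  show "inner (a *\<^sub>R x) y = a * inner x y"
    by transfer (simp add: l2_inner_scale_left)
  show "0 \<le> inner x x"
    by transfer simp
  show "inner x x = 0 \<longleftrightarrow> x = 0"
    by transfer (rule Re_l2_inner_self_eq_0_iff)
qed (simp_all add: norm_l2_def dist_l2_def sgn_l2_def uniformity_l2_def open_l2_def)

end

lemma norm_l2_eq: "norm x = l2_norm (Rep_l2 x)"
  by (simp add: norm_l2_def inner_l2.rep_eq l2_norm_def)

lemma dist_l2_eq: "dist x y = l2_norm (Rep_l2 x - Rep_l2 y)"
  by (simp add: dist_norm norm_l2_eq minus_l2.rep_eq)

instance l2 :: complete_space
proof
  fix X :: "nat \<Rightarrow> l2" assume X: "Cauchy X"
  have "\<exists>N. \<forall>m\<ge>N. \<forall>n\<ge>N. Re (l2_inner (Rep_l2 (X m) - Rep_l2 (X n)) (Rep_l2 (X m) - Rep_l2 (X n))) < e"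
    if "e > 0" for e
  proof -
    obtain N where "\<forall>m\<ge>N. \<forall>n\<ge>N. dist (X m) (X n) < sqrt e"
      using metric_CauchyD[OF X, of "sqrt e"] \<open>e > 0\<close> by auto
    then show ?thesis by (auto simp: dist_l2_eq l2_norm_def)
  qed
  from L2_complete[OF Rep_l2 this] obtain G where
    G: "G \<in> L2" "\<And>e. e > 0 \<Longrightarrow> \<exists>N. \<forall>n\<ge>N. Re (l2_inner (Rep_l2 (X n) - G) (Rep_l2 (X n) - G)) \<le> e"
    by blast
  have "X \<longlonglongrightarrow> Abs_l2 G"
  proof (rule metric_LIMSEQ_I)
    fix e :: real assume "e > 0"
    then have "0 < (e / 2)\<^sup>2" by simp
    from G(2)[OF this] obtain N where
      N: "\<And>n. n \<ge> N \<Longrightarrow> l2_norm (Rep_l2 (X n) - G) \<le> e / 2"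
      unfolding l2_norm_def using \<open>e > 0\<close> real_sqrt_le_iff[of _ "(e / 2)\<^sup>2"]
      by (metis less_imp_le real_sqrt_abs abs_of_pos half_gt_zero)
    then show "\<exists>N. \<forall>n\<ge>N. dist (X n) (Abs_l2 G) < e"
      using \<open>e > 0\<close> by (force simp: dist_l2_eq Abs_l2_inverse[OF G(1)])
  qed
  then show "convergent X" by (rule convergentI)
qed

lemma Metric_space_L2: "Metric_space L2 (\<lambda>f g. l2_norm (f - g))"
proof
  fix f g k
  show "0 \<le> l2_norm (f - g)" by (simp add: l2_norm_def)
  show "l2_norm (f - g) = l2_norm (g - f)"
    unfolding l2_norm_def by transfer (simp add: algebra_simps)
  assume fg: "f \<in> L2" "g \<in> L2"
  show "l2_norm (f - g) = 0 \<longleftrightarrow> f = g"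
    using L2_diff[OF fg] Re_l2_inner_self_eq_0_iff by (auto simp: l2_norm_def)
  assume "k \<in> L2"
  with fg show "l2_norm (f - k) \<le> l2_norm (f - g) + l2_norm (g - k)"
    using dist_triangle[of "Abs_l2 f" "Abs_l2 k" "Abs_l2 g"] by (simp add: dist_l2_eq Abs_l2_inverse)
qed

lemma closed_vimage_Rep_l2:
  assumes "closedin l2_topology M"
  shows "closed (Rep_l2 -` M)"
  unfolding closed_sequential_limits
proof (intro allI impI, elim conjE)
  interpret Metric_space L2 "\<lambda>f g. l2_norm (f - g)" by (rule Metric_space_L2)
  fix X l assume X: "\<forall>n. X n \<in> Rep_l2 -` M" and "X \<longlonglongrightarrow> l"
  then have "limitin l2_topology (\<lambda>n. Rep_l2 (X n)) (Rep_l2 l) sequentially"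
    by (simp add: limit_metric_sequentially Rep_l2 lim_sequentially dist_l2_eq)
  then show "l \<in> Rep_l2 -` M"
    using limitin_closedin[OF _ assms, of "\<lambda>n. Rep_l2 (X n)" "Rep_l2 l" sequentially] X by simp
qed

section \<open>Orthogonal decomposition and projections in \<open>L\<^sup>2\<close>\<close>

text \<open>
  The projection theorem yields orthogonality only for the real part of the inner product.
  As \<open>M\<close> is a complex subspace, testing against \<open>\<i> k\<close> as well gives the imaginary part.
\<close>
lemma L2_orthogonal_decomposition:
  assumes M: "closed_subspace_of M L2" and f: "f \<in> L2"
  obtains p q where "p \<in> M" "q \<in> L2 \<ominus> M" "f = p + q"
proof -
  have ML2: "M \<subseteq> L2" and cl: "closedin l2_topology M"
    and sub: "0 \<in> M" "\<And>x y. x \<in> M \<Longrightarrow> y \<in> M \<Longrightarrow> x + y \<in> M" "\<And>c x. x \<in> M \<Longrightarrow> const_fun c * x \<in> M"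
    using M unfolding closed_subspace_of_def module.subspace_def[OF module_circle_fun] by auto
  have "subspace (Rep_l2 -` M)"
    using sub by (simp add: subspace_def zero_l2.rep_eq plus_l2.rep_eq scaleR_l2.rep_eq)
  from orthogonal_projection_exists[OF this closed_vimage_Rep_l2[OF cl], of "Abs_l2 f"]
  obtain P where P: "Rep_l2 P \<in> M" "\<And>k. Rep_l2 k \<in> M \<Longrightarrow> inner (Abs_l2 f - P) k = 0"
    by auto
  define p where "p = Rep_l2 P"
  have re: "Re (l2_inner (f - p) k) = 0" if "k \<in> M" for k
    using P(2)[of "Abs_l2 k"] that ML2 f
    by (auto simp: p_def inner_l2.rep_eq minus_l2.rep_eq Abs_l2_inverse)
  have "l2_inner (f - p) k = 0" if "k \<in> M" for k
  proof (rule complex_eqI)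
    show "Im (l2_inner (f - p) k) = Im 0"
      using re[OF sub(3)[OF that, of \<i>]] by (simp add: l2_inner_scale_right)
  qed (use re that in simp)
  then have "f - p \<in> L2 \<ominus> M"
    using L2_diff[OF f, of p] P(1) ML2 unfolding ominus_def p_def by auto
  then show ?thesis
    using that[of p "f - p"] P(1) by (simp add: p_def)
qed

text \<open>
  The definite description in \<open>oproj\<close> is resolved here by uniqueness: two candidates differ by an
  element of the complement that is orthogonal to itself.
\<close>
lemma oproj_orthogonal_complement:
  assumes M: "M \<subseteq> L2" and p: "p \<in> M" and q: "q \<in> L2 \<ominus> M"
  shows "oproj (L2 \<ominus> M) (p + q) = q"
  unfolding oproj_def
proof (rule the_equality)
  have pk: "l2_inner p k = 0" if "k \<in> L2 \<ominus> M" for k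
    using that p cnj_l2_inner[of k p] by (auto simp: ominus_def)
  then show "q \<in> L2 \<ominus> M \<and> (\<forall>k\<in>L2 \<ominus> M. l2_inner (p + q - q) k = 0)"
    using q by simp
  have L2: "p \<in> L2" "q \<in> L2"
    using M p q by (auto simp: ominus_def)
  fix g assume g: "g \<in> L2 \<ominus> M \<and> (\<forall>k\<in>L2 \<ominus> M. l2_inner (p + q - g) k = 0)"
  then have gL2: "g \<in> L2" by (simp add: ominus_def)
  have d: "q - g \<in> L2 \<ominus> M"
    using g q M by (simp add: ominus_def L2_diff l2_inner_diff_left subset_iff)
  then have "l2_inner (p + q - g) (q - g) = 0"
    using g by blast
  then have "0 = l2_inner (p + (q - g)) (q - g)"
    by (simp add: add_diff_eq)
  also have "\<dots> = l2_inner (q - g) (q - g)"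
    using L2 gL2 d by (simp add: l2_inner_add_left L2_diff pk)
  finally show "g = q"
    using Re_l2_inner_self_eq_0_iff[OF L2_diff[OF L2(2) gL2]] by simp
qed

lemma unimodular_in_Linf: "unimodular u \<Longrightarrow> u \<in> Linf"
  unfolding Linf_def mem_Collect_eq by transfer (auto elim!: eventually_mono intro!: exI[of _ 1])

section \<open>Linearity of the model space, and polarization\<close>

lemma H2_subspace: "module.subspace (\<lambda>c f. const_fun c * f) H2"
proof -
  \<comment> \<open>Additivity of the coefficients is not formal: the integral of a non-integrable function is 0.\<close>
  have int: "integrable circle_measure (\<lambda>z. f z * z powi (- n))"
    if [measurable]: "f \<in> borel_measurable circle_measure"
      and f: "integrable circle_measure (\<lambda>z. (cmod (f z))\<^sup>2)" for f n
  proof (rule Bochner_Integration.integrable_bound)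
    interpret prob_space circle_measure by (rule prob_space_circle_measure)
    show "integrable circle_measure (\<lambda>z. 1 + (cmod (f z))\<^sup>2)"
      using f by simp
    show "AE z in circle_measure. cmod (f z * z powi (- n)) \<le> norm (1 + (cmod (f z))\<^sup>2)"
    proof (rule AE_I2)
      fix z assume "z \<in> space circle_measure"
      then have "cmod (f z * z powi (- n)) = cmod (f z)"
        by (simp add: norm_mult norm_power_int)
      then show "cmod (f z * z powi (- n)) \<le> norm (1 + (cmod (f z))\<^sup>2)"
        using sum_squares_bound[of "cmod (f z)" 1] norm_ge_zero[of "f z"]
        by (simp del: norm_ge_zero)
    qed
  qed measurable
  have add: "fourier_coeff (f + g) n = fourier_coeff f n + fourier_coeff g n"
    if "f \<in> L2" "g \<in> L2" for f g n
    using that unfolding L2_def mem_Collect_eq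
    by transfer (auto simp: ring_distribs int)
  have scale: "fourier_coeff (const_fun c * f) n = c * fourier_coeff f n" for c f n
    by transfer (simp add: mult.assoc)
  have zero: "fourier_coeff 0 n = 0" for n
    by transfer simp
  show ?thesis
    unfolding module.subspace_def[OF module_circle_fun] H2_def
    by (auto simp: zero_in_L2 zero L2_add add L2_scale scale)
qed

lemma model_space_subspace:
  assumes "inner_function u"
  shows "module.subspace (\<lambda>c f. const_fun c * f) (model_space u)"
proof -
  have H2: "f \<in> L2" if "f \<in> H2" for f
    using that by (simp add: H2_def)
  have "u * g \<in> L2" if "g \<in> H2" for g
    using that assms by (intro L2_Linf_mult unimodular_in_Linf H2) (auto simp: inner_function_def)
  then show ?thesis
    using H2_subspace unfolding module.subspace_def[OF module_circle_fun] model_space_def ominus_def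
    by (auto simp: l2_inner_add_left l2_inner_scale_left H2)
qed

text \<open>
  Polarization: norms of sums determine the real part of the inner product, and replacing \<open>y\<close> by
  \<open>\<i> y\<close> gives the imaginary part.
\<close>
lemma isometry_onto_mult_preserves_l2_inner:
  assumes A: "module.subspace (\<lambda>c f. const_fun c * f) A" "A \<subseteq> L2" and B: "B \<subseteq> L2"
    and iso: "isometry_onto (\<lambda>k. h * k) A B" and x: "x \<in> A" and y: "y \<in> A"
  shows "l2_inner (h * x) (h * y) = l2_inner x y"
proof -
  have sub: "\<And>x y. x \<in> A \<Longrightarrow> y \<in> A \<Longrightarrow> x + y \<in> A" "\<And>c x. x \<in> A \<Longrightarrow> const_fun c * x \<in> A"
    using A(1) unfolding module.subspace_def[OF module_circle_fun] by auto
  have norm: "Re (l2_inner (h * x) (h * x)) = Re (l2_inner x x)" if "x \<in> A" for x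
    using iso that by (simp add: isometry_onto_def l2_norm_def)
  have hL2: "h * x \<in> L2" if "x \<in> A" for x
    using iso that B by (auto simp: isometry_onto_def)
  have re: "Re (l2_inner (h * x) (h * y)) = Re (l2_inner x y)" if "x \<in> A" "y \<in> A" for x y
  proof -
    have polar: "Re (l2_inner (f + g) (f + g)) = Re (l2_inner f f) + Re (l2_inner g g) + 2 * Re (l2_inner f g)"
      if "f \<in> L2" "g \<in> L2" for f g
      using cnj_l2_inner[of f g, symmetric] that
      by (simp add: l2_inner_add_left l2_inner_add_right L2_add)
    have "h * (x + y) = h * x + h * y" by (simp add: ring_distribs)
    then show ?thesis
      using norm[OF sub(1)[OF that]] polar[of x y] polar[of "h * x" "h * y"] norm that hL2
        subsetD[OF A(2)] by auto
  qed
  show ?thesis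
  proof (rule complex_eqI)
    show "Re (l2_inner (h * x) (h * y)) = Re (l2_inner x y)" by (rule re[OF x y])
    show "Im (l2_inner (h * x) (h * y)) = Im (l2_inner x y)"
      using re[OF x sub(2)[OF y, of \<i>]]
      unfolding mult.left_commute[of h "const_fun \<i>"] l2_inner_scale_right by simp
  qed
qed

section \<open>The defect of multiplicativity\<close>

text \<open>
  An element of \<open>A\<close> is determined by its inner products with \<open>A\<close>, so exhibiting one candidate with the
  defining property of the adjoint identifies its value.
\<close>
lemma adjoint_on_equality:
  assumes A: "module.subspace (\<lambda>c f. const_fun c * f) A" "A \<subseteq> L2"
    and k: "k \<in> A" "\<And>x. x \<in> A \<Longrightarrow> l2_inner (T x) g = l2_inner x k"
  shows "adjoint_on A T g = k"
  unfolding adjoint_on_def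
proof (rule the_equality)
  show "k \<in> A \<and> (\<forall>x\<in>A. l2_inner (T x) g = l2_inner x k)"
    using k by blast
  fix k' assume k': "k' \<in> A \<and> (\<forall>x\<in>A. l2_inner (T x) g = l2_inner x k')"
  then have d: "k' - k \<in> A"
    using A(1) k(1) module.subspace_diff[OF module_circle_fun] by blast
  then have "l2_inner (k' - k) (k' - k) = 0"
    using k k' A(2) by (simp add: l2_inner_diff_right subset_iff)
  then show "k' = k"
    using Re_l2_inner_self_eq_0_iff[of "k' - k"] d A(2) by auto
qed

theorem proposition4p2:
  fixes M :: "circle_fun set" and u h \<phi> \<psi> :: circle_fun
  assumes "nearly_invariant M" and "M \<noteq> {0}" and "M \<noteq> H2"
    and "inner_function u" and "\<forall>c. u \<noteq> const_fun c" and "disk_ext u 0 = 0"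
    and "extremal_function M h"
    and "isometry_onto (\<lambda>k. h * k) (model_space u) M"
    and "\<phi> \<in> Linf" and "\<psi> \<in> Linf"
  shows "\<forall>f \<in> L2 \<ominus> M.
    dual_trunc_toeplitz M (\<phi> * \<psi>) f - dual_trunc_toeplitz M \<phi> (dual_trunc_toeplitz M \<psi> f) =
    weighted_trunc_hankel M h \<phi>
      (adjoint_on (model_space u) (weighted_trunc_hankel M h (cnj_fun \<psi>)) f)"
proof
  fix f assume f: "f \<in> L2 \<ominus> M"
  then have fL2: "f \<in> L2" by (simp add: ominus_def)
  note \<phi> = \<open>\<phi> \<in> Linf\<close> and \<psi> = \<open>\<psi> \<in> Linf\<close>
  note iso = \<open>isometry_onto (\<lambda>k. h * k) (model_space u) M\<close>
  have "H2 \<subseteq> L2" by (auto simp: H2_def)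
  then have M: "closed_subspace_of M L2" and ML2: "M \<subseteq> L2" and KL2: "model_space u \<subseteq> L2"
    using \<open>nearly_invariant M\<close>
    by (auto simp: nearly_invariant_def closed_subspace_of_def model_space_def ominus_def)
  note K = model_space_subspace[OF \<open>inner_function u\<close>]
  note oproj = oproj_orthogonal_complement[OF ML2]
  obtain p q where pq: "p \<in> M" "q \<in> L2 \<ominus> M" "\<psi> * f = p + q"
    by (rule L2_orthogonal_decomposition[OF M L2_Linf_mult[OF \<psi> fL2]])
  then have pqL2: "p \<in> L2" "q \<in> L2" using ML2 by (auto simp: ominus_def)
  obtain p1 q1 where pq1: "p1 \<in> M" "q1 \<in> L2 \<ominus> M" "\<phi> * p = p1 + q1"
    by (rule L2_orthogonal_decomposition[OF M L2_Linf_mult[OF \<phi> pqL2(1)]])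
  obtain p2 q2 where pq2: "p2 \<in> M" "q2 \<in> L2 \<ominus> M" "\<phi> * q = p2 + q2"
    by (rule L2_orthogonal_decomposition[OF M L2_Linf_mult[OF \<phi> pqL2(2)]])
  have pq12: "p1 + p2 \<in> M" "q1 + q2 \<in> L2 \<ominus> M"
    using pq1 pq2 M ML2 module.subspace_add[OF module_circle_fun]
    by (auto simp: closed_subspace_of_def ominus_def L2_add l2_inner_add_left subset_iff)
  have "(\<phi> * \<psi>) * f = (p1 + p2) + (q1 + q2)"
    using pq(3) pq1(3) pq2(3) by (simp add: mult.assoc ring_distribs ac_simps)
  \<comment> \<open>\<open>q1\<close> is \<open>Q (\<phi> P (\<psi> f))\<close>, the common value of the two sides.\<close>
  then have lhs: "dual_trunc_toeplitz M (\<phi> * \<psi>) f - dual_trunc_toeplitz M \<phi> (dual_trunc_toeplitz M \<psi> f) = q1"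
    using oproj pq pq1 pq2 pq12 by (simp add: dual_trunc_toeplitz_def)
  obtain k where k: "k \<in> model_space u" "p = h * k"
    using iso pq(1) by (auto simp: isometry_onto_def)
  have "adjoint_on (model_space u) (weighted_trunc_hankel M h (cnj_fun \<psi>)) f = k"
  proof (rule adjoint_on_equality[OF K KL2 k(1)])
    fix x assume x: "x \<in> model_space u"
    then have hx: "h * x \<in> M" using iso by (auto simp: isometry_onto_def)
    then have hxL2: "h * x \<in> L2" using ML2 by blast
    obtain a b where ab: "a \<in> M" "b \<in> L2 \<ominus> M" "cnj_fun \<psi> * (h * x) = a + b"
      by (rule L2_orthogonal_decomposition[OF M L2_Linf_mult[OF cnj_fun_in_Linf[OF \<psi>] hxL2]])
    then have abL2: "a \<in> L2" "b \<in> L2" using ML2 by (auto simp: ominus_def)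
    have perp: "l2_inner m g = 0" if "m \<in> M" "g \<in> L2 \<ominus> M" for m g
      using that cnj_l2_inner[of g m] by (auto simp: ominus_def)
    have "l2_inner (weighted_trunc_hankel M h (cnj_fun \<psi>) x) f = l2_inner b f"
      using oproj ab by (simp add: weighted_trunc_hankel_def)
    also have "\<dots> = l2_inner (cnj_fun \<psi> * (h * x)) f"
      using perp[OF ab(1) f] by (simp add: ab(3) l2_inner_add_left abL2 fL2)
    also have "\<dots> = l2_inner (h * x) (\<psi> * f)"
      by (simp add: l2_inner_mult_left)
    also have "\<dots> = l2_inner (h * x) p"
      using perp[OF hx pq(2)] by (simp add: pq(3) l2_inner_add_right pqL2 hxL2)
    also have "\<dots> = l2_inner x k"
      unfolding k(2) by (rule isometry_onto_mult_preserves_l2_inner[OF K KL2 ML2 iso x k(1)])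
    finally show "l2_inner (weighted_trunc_hankel M h (cnj_fun \<psi>) x) f = l2_inner x k" .
  qed
  then have "weighted_trunc_hankel M h \<phi>
      (adjoint_on (model_space u) (weighted_trunc_hankel M h (cnj_fun \<psi>)) f) = q1"
    using oproj pq1 k(2) by (simp add: weighted_trunc_hankel_def)
  with lhs show "dual_trunc_toeplitz M (\<phi> * \<psi>) f - dual_trunc_toeplitz M \<phi> (dual_trunc_toeplitz M \<psi> f) =
    weighted_trunc_hankel M h \<phi>
      (adjoint_on (model_space u) (weighted_trunc_hankel M h (cnj_fun \<psi>)) f)" by simp
qed

end
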